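(* Let $p$ be an odd prime and let $r\in\mathbb{N}$, $r\geq 1$. Then the Laplacian spectrum of $\Gamma(\mathbb{Z}_{p^r})$ is the multiset consisting of the following Laplacian eigenvalues with the following multiplicities: $0$ with multiplicity $\frac{1}{2}(p^{r-1}+1)$; $2(p-1)$ with multiplicity $\frac{1}{2}(p^{r-1}-1)$; $p$ with multiplicity $\frac{1}{2}(p^r-p^{r-1})$; and $p-2$ with multiplicity $\frac{1}{2}(p^r-p^{r-1})$.
   Context: For a finite group $G$, the prime order element graph $\Gamma(G)$ is the simple undirected graph (no loops) with vertex set $G$ in which two distinct vertices $x,y\in G$ are adjacent if and only if the order of the product $xy$ (the sum $x+y$ if $G$ is written additively) is a prime number. $\mathbb{Z}_m$ denotes the cyclic group of order $m$. The Laplacian matrix of a graph is $D-A$, where $D$ is the diagonal matrix of vertex degrees and $A$ is the adjacency matrix; the Laplacian spectrum is the multiset of eigenvalues of the Laplacian matrix. A value listed with multiplicity $0$ does not occur as an eigenvalue. *)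

theory Defs
  imports
    "HOL-Algebra.Multiplicative_Group"
    "HOL-Algebra.Elementary_Groups"
    "HOL-Computational_Algebra.Primes"
    "HOL-Combinatorics.List_Permutation"
    "Graph_Theory.Pair_Digraph"
    "Jordan_Normal_Form.Spectral_Radius"
begin

text \<open>
  Following the Graph Theory entry of the AFP, a simple undirected graph is a digraph whose arc relation is
  symmetric and irreflexive (locale \<open>pair_graph\<close>): every undirected edge is represented
  by its two orientations, so the degree of a vertex is its out-degree.
\<close>

definition prime_order_graph :: "('a, 'b) monoid_scheme \<Rightarrow> 'a pair_pre_digraph" where
  "prime_order_graph G =
     \<lparr> pverts = carrier G,
       parcs = {(x, y). x \<in> carrier G \<and> y \<in> carrier G \<and> x \<noteq> y \<and>
                        prime (group.ord G (x \<otimes>\<^bsub>G\<^esub> y))} \<rparr>"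

text \<open>
  The ordering of the rows and columns is given by a list \<open>vs\<close> enumerating the vertices.
  Entries are complex so that the spectrum below comprises all eigenvalues.
\<close>

definition degree_matrix :: "'a list \<Rightarrow> 'a pair_pre_digraph \<Rightarrow> complex mat" where
  "degree_matrix vs \<Gamma> =
     mat (length vs) (length vs)
       (\<lambda>(i, j). if i = j then of_nat (out_degree (with_proj \<Gamma>) (vs ! i)) else 0)"

definition adjacency_matrix :: "'a list \<Rightarrow> 'a pair_pre_digraph \<Rightarrow> complex mat" where
  "adjacency_matrix vs \<Gamma> =
     mat (length vs) (length vs) (\<lambda>(i, j). if (vs ! i, vs ! j) \<in> parcs \<Gamma> then 1 else 0)"

definition laplacian_matrix :: "'a list \<Rightarrow> 'a pair_pre_digraph \<Rightarrow> complex mat" where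
  "laplacian_matrix vs \<Gamma> = degree_matrix vs \<Gamma> - adjacency_matrix vs \<Gamma>"

text \<open>Eigenvalues with algebraic multiplicity.\<close>

definition eigenvalue_mset :: "complex mat \<Rightarrow> complex multiset" where
  "eigenvalue_mset A = proots (char_poly A)"

text \<open>
  Meaningful for finite graphs only; the choice of the enumeration is immaterial by
  \<open>laplacian_spectrum_eq\<close> below.
\<close>

definition laplacian_spectrum :: "'a pair_pre_digraph \<Rightarrow> complex multiset" where
  "laplacian_spectrum \<Gamma> =
     eigenvalue_mset (laplacian_matrix (SOME vs. distinct vs \<and> set vs = pverts \<Gamma>) \<Gamma>)"

lemma pair_graph_prime_order_graph:
  fixes G (structure)
  assumes "group G" and "finite (carrier G)"
  shows "pair_graph (prime_order_graph G)"
proof -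
  interpret group G by fact
  have conj_ord: "ord (y \<otimes> x) = ord (x \<otimes> y)" if "x \<in> carrier G" "y \<in> carrier G" for x y
  proof -
    have imp: "(v \<otimes> u) [^] n = \<one>"
      if "(u \<otimes> v) [^] n = \<one>" and [simp]: "u \<in> carrier G" "v \<in> carrier G" for u v and n :: nat
    proof -
      have eq: "u \<otimes> (v \<otimes> u) [^] k = (u \<otimes> v) [^] k \<otimes> u" for k :: nat
      proof (induction k)
        case (Suc k)
        have "u \<otimes> (v \<otimes> u) [^] Suc k = (u \<otimes> (v \<otimes> u) [^] k) \<otimes> (v \<otimes> u)"
          by (simp add: m_assoc)
        also have "\<dots> = (u \<otimes> v) [^] Suc k \<otimes> u"
          unfolding Suc by (simp add: m_assoc)
        finally show ?case .
      qed simp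
      from eq[of n] that(1) have "u \<otimes> (v \<otimes> u) [^] n = u" by simp
      then show ?thesis by (simp add: r_cancel_one)
    qed
    have "((y \<otimes> x) [^] n = \<one>) = ((x \<otimes> y) [^] n = \<one>)" for n :: nat
      using imp that by blast
    then show ?thesis unfolding ord_def by simp
  qed
  have "finite (parcs (prime_order_graph G))"
    by (rule finite_subset[of _ "carrier G \<times> carrier G"])
       (auto simp: prime_order_graph_def assms(2))
  moreover have "sym (parcs (prime_order_graph G))"
    unfolding sym_def prime_order_graph_def by (auto simp: conj_ord)
  ultimately show ?thesis
    by unfold_locales
       (auto simp: prime_order_graph_def symmetric_def assms(2))
qed

lemma set_mset_eigenvalue_mset:
  assumes A: "A \<in> carrier_mat n n"
  shows "set_mset (eigenvalue_mset A) = spectrum A"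
proof -
  have "char_poly A \<noteq> 0" using degree_monic_char_poly[OF A] by auto
  then show ?thesis
    by (simp add: eigenvalue_mset_def spectrum_root_char_poly[OF A])
qed

lemma det_permute_rows_cols:
  fixes M :: "'b :: comm_ring_1 mat"
  assumes M: "M \<in> carrier_mat n n" and p: "p permutes {0..<n}"
  shows "det (mat n n (\<lambda>(i, j). M $$ (p i, p j))) = det M"
proof -
  let ?R = "mat n n (\<lambda>(i, j). M $$ (p i, j))"
  have pn: "p i < n" if "i < n" for i using permutes_in_image[OF p, of i] that by simp
  have "det (mat n n (\<lambda>(i, j). M $$ (p i, p j)))
      = det (transpose_mat (mat n n (\<lambda>(i, j). M $$ (p i, p j))))"
    by (rule det_transpose[symmetric, where n = n]) simp
  also have "transpose_mat (mat n n (\<lambda>(i, j). M $$ (p i, p j)))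
      = mat n n (\<lambda>(i, j). transpose_mat ?R $$ (p i, j))"
    by (rule eq_matI) (auto simp: pn)
  also have "det \<dots> = signof p * det (transpose_mat ?R)"
    by (rule det_permute_rows[OF _ p]) simp
  also have "det (transpose_mat ?R) = det ?R"
    by (rule det_transpose[where n = n]) simp
  also have "det ?R = signof p * det M"
    by (rule det_permute_rows[OF M p])
  also have "signof p * (signof p * det M) = det M"
    by (auto simp: sign_def)
  finally show ?thesis .
qed

lemma char_poly_laplacian_matrix_cong:
  assumes "distinct vs" "distinct ws" "set vs = set ws"
  shows "char_poly (laplacian_matrix ws \<Gamma>) = char_poly (laplacian_matrix vs \<Gamma>)"
proof -
  define n where "n = length vs"
  have ms: "mset ws = mset vs" using assms by (simp add: set_eq_iff_mset_eq_distinct)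
  then obtain p where p: "p permutes {..<n}" "permute_list p vs = ws"
    unfolding n_def by (rule mset_eq_permutation)
  have len: "length ws = n" using ms n_def by (metis mset_eq_length)
  have p': "p permutes {0..<n}" using p(1) by (simp add: atLeast0LessThan)
  have pn: "p i < n" if "i < n" for i using permutes_in_image[OF p', of i] that by simp
  have nth: "ws ! i = vs ! p i" if "i < n" for i
    using permute_list_nth[of p vs i] p that by (simp add: n_def)
  have inj: "p i = p j \<longleftrightarrow> i = j" for i j
    using permutes_inj[OF p'] by (auto dest: injD)
  let ?M = "char_poly_matrix (laplacian_matrix vs \<Gamma>)"
  have M: "?M \<in> carrier_mat n n"
    by (simp add: laplacian_matrix_def adjacency_matrix_def degree_matrix_def n_def
        minus_mat_def)
  have "char_poly_matrix (laplacian_matrix ws \<Gamma>) = mat n n (\<lambda>(i, j). ?M $$ (p i, p j))"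
    by (rule eq_matI)
       (auto simp: char_poly_matrix_def laplacian_matrix_def adjacency_matrix_def
          degree_matrix_def len pn nth inj n_def[symmetric])
  then show ?thesis
    unfolding char_poly_def using det_permute_rows_cols[OF M p'] by simp
qed

lemma laplacian_spectrum_eq:
  assumes "distinct vs" "set vs = pverts \<Gamma>"
  shows "laplacian_spectrum \<Gamma> = eigenvalue_mset (laplacian_matrix vs \<Gamma>)"
proof -
  let ?ws = "SOME vs. distinct vs \<and> set vs = pverts \<Gamma>"
  have "distinct ?ws \<and> set ?ws = pverts \<Gamma>" by (rule someI[of _ vs]) (use assms in simp)
  then show ?thesis
    unfolding laplacian_spectrum_def eigenvalue_mset_def
    using char_poly_laplacian_matrix_cong[of vs ?ws \<Gamma>] assms by simp
qed

end

theory Submission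
  imports Defs "HOL-Library.Real_Mod"
begin

text \<open>
  For \<open>n = p ^ r\<close> let \<open>N\<close> be the permutation matrix of \<open>x \<mapsto> - x\<close>, and let \<open>J\<close> have the entry 1 at
  \<open>(x, y)\<close> iff \<open>x - y\<close> lies in the subgroup of order \<open>p\<close>. Discarding loops from the relation
  ``\<open>x + y\<close> has order \<open>p\<close>'' changes degree and adjacency matrix by the same diagonal matrix, so the
  Laplacian is \<open>(p - 1) I - N (J - I)\<close>. On the characters \<open>\<chi>\<^sub>k\<close> of \<open>\<int>\<^sub>n\<close>, \<open>N\<close> exchanges \<open>\<chi>\<^sub>k\<close>
  and \<open>\<chi>\<^bsub>-k\<^esub>\<close>, and \<open>J\<close> acts as \<open>p\<close> if \<open>p dvd k\<close> and as 0 otherwise. Hence the vectors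
  \<open>\<chi>\<^sub>k + \<chi>\<^bsub>-k\<^esub>\<close> for \<open>2 k < n\<close> and \<open>\<chi>\<^sub>k - \<chi>\<^bsub>-k\<^esub>\<close> for \<open>n < 2 k < 2 n\<close> form an orthogonal
  eigenbasis.
\<close>

subsection \<open>Characters of cyclic groups\<close>

text \<open>Index and argument enter only through their product: the \<open>k\<close>-th character
  of Z_n is \<open>cyc_char n (k * z)\<close> as a function of \<open>z\<close>.\<close>

definition cyc_char :: "nat \<Rightarrow> int \<Rightarrow> complex" where
  "cyc_char n z = cis (2 * pi * (of_int z / of_nat n))"

lemma cyc_char_0 [simp]: "cyc_char n 0 = 1"
  by (simp add: cyc_char_def)

lemma cyc_char_add: "cyc_char n (a + b) = cyc_char n a * cyc_char n b"
  by (simp add: cyc_char_def cis_mult add_divide_distrib distrib_left)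

lemma cyc_char_mult_nat: "cyc_char n (a * int k) = cyc_char n a ^ k"
  by (induction k) (simp_all add: cyc_char_add distrib_left)

lemma cyc_char_eq_1_iff:
  assumes "n > 0"
  shows "cyc_char n z = 1 \<longleftrightarrow> int n dvd z"
proof -
  have "cyc_char n z = 1 \<longleftrightarrow> (\<exists>k::int. 2 * pi * (of_int z / of_nat n) = of_int k * (2 * pi))"
    by (simp add: cyc_char_def cis_eq_1_iff)
  also have "\<dots> \<longleftrightarrow> (\<exists>k::int. real_of_int z = real_of_int (int n * k))"
    using assms by (simp add: field_simps)
  also have "\<dots> \<longleftrightarrow> int n dvd z"
    unfolding of_int_eq_iff dvd_def ..
  finally show ?thesis .
qed

lemma cyc_char_cong:
  assumes "n > 0" and "int n dvd a - b"
  shows "cyc_char n a = cyc_char n b"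
  using cyc_char_add[of n "a - b" b] assms by (simp add: cyc_char_eq_1_iff[THEN iffD2])

text \<open>On the multiples of \<open>m\<close>, the subgroup of order \<open>p\<close> in Z_(p m),
  a character becomes a character of Z_p.\<close>

lemma cyc_char_mult_cancel:
  assumes "m > 0"
  shows "cyc_char (p * m) (int m * z) = cyc_char p z"
  using assms by (simp add: cyc_char_def)

text \<open>The summands are powers of an \<open>n\<close>-th root of unity, so the geometric sum
  vanishes unless the ratio is 1.\<close>

lemma sum_cyc_char:
  assumes "n > 0"
  shows "(\<Sum>x<n. cyc_char n (a * int x)) = (if int n dvd a then of_nat n else 0)"
proof (cases "int n dvd a")
  case True
  then show ?thesis by (simp add: cyc_char_mult_nat cyc_char_eq_1_iff[THEN iffD2] assms)
next
  case False
  then have "cyc_char n a \<noteq> 1" by (simp add: cyc_char_eq_1_iff assms)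
  moreover have "cyc_char n a ^ n = 1"
    using assms by (simp add: cyc_char_eq_1_iff flip: cyc_char_mult_nat)
  ultimately show ?thesis
    using False by (simp add: cyc_char_mult_nat geometric_sum)
qed

text \<open>For odd \<open>n\<close> and \<open>0 < k < n\<close>, exactly one of \<open>k\<close>
  and \<open>n - k\<close> lies below \<open>n / 2\<close>, so each conjugate pair of characters
  yields one sum and one difference. Index 0 gets the sign +1, which makes its vector the constant 2
  and not 0.\<close>

definition half_sign :: "nat \<Rightarrow> nat \<Rightarrow> complex" where
  "half_sign n k = (if 2 * k < n then 1 else - 1)"

definition sym_char :: "nat \<Rightarrow> nat \<Rightarrow> int \<Rightarrow> complex" where
  "sym_char n k z = cyc_char n (int k * z) + half_sign n k * cyc_char n (- int k * z)"

lemma half_sign_sq [simp]: "half_sign n k * half_sign n k = 1"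
  by (simp add: half_sign_def)

lemma sym_char_cong:
  assumes "n > 0" and "int n dvd a - b"
  shows "sym_char n k a = sym_char n k b"
proof -
  have "cyc_char n (c * a) = cyc_char n (c * b)" for c
    by (rule cyc_char_cong[OF assms(1)]) (use assms(2) in \<open>simp flip: right_diff_distrib\<close>)
  from this[of "int k"] this[of "- int k"] show ?thesis by (simp only: sym_char_def)
qed

lemma sym_char_minus: "sym_char n k (- z) = half_sign n k * sym_char n k z"
  by (simp add: sym_char_def distrib_left flip: mult.assoc)

text \<open>For \<open>k = 0\<close> both summands of the character sum are constant, which doubles the norm.\<close>

lemma sym_char_orthogonal:
  assumes "odd n" and "k < n" and "l < n"
  shows "(\<Sum>x<n. sym_char n k (- int x) * sym_char n l (int x)) =
    (if k = l then (if k = 0 then 4 else 2) * of_nat n else 0)"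
proof -
  have n: "n > 0" using assms by simp
  let ?s = "half_sign n"
  let ?e = "\<lambda>a. \<Sum>x<n. cyc_char n (a * int x)"
  have dvd_diff: "int n dvd int l - int k \<longleftrightarrow> k = l"
    using assms(2,3) by (auto simp flip: mod_eq_dvd_iff)
  have dvd_add: "int n dvd int l + int k \<longleftrightarrow> (k = 0 \<and> l = 0) \<or> k + l = n"
  proof
    assume "int n dvd int l + int k"
    then obtain c where c: "l + k = n * c"
      by (metis dvd_def int_dvd_int_iff of_nat_add)
    then have "n * c < n * 2" using assms by linarith
    then have "c < 2" by simp
    then have "c = 0 \<or> c = 1" by auto
    then show "(k = 0 \<and> l = 0) \<or> k + l = n" using c by auto
  next
    assume "(k = 0 \<and> l = 0) \<or> k + l = n"
    then show "int n dvd int l + int k" by (auto simp flip: of_nat_add simp: add.commute)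
  qed
  have neg: "int n dvd - a \<longleftrightarrow> int n dvd a" for a by simp
  have "(\<Sum>x<n. sym_char n k (- int x) * sym_char n l (int x)) =
      ?e (int l - int k) + ?s l * ?e (- (int l + int k)) + ?s k * ?e (int l + int k)
        + ?s k * ?s l * ?e (- (int l - int k))"
    unfolding sum_distrib_left sum.distrib[symmetric]
  proof (rule sum.cong[OF refl])
    fix x
    have *: "cyc_char n (int k * - int x) * cyc_char n (int l * int x) = cyc_char n ((int l - int k) * int x)"
      "cyc_char n (int k * - int x) * cyc_char n (- int l * int x) = cyc_char n (- (int l + int k) * int x)"
      "cyc_char n (- int k * - int x) * cyc_char n (int l * int x) = cyc_char n ((int l + int k) * int x)"
      "cyc_char n (- int k * - int x) * cyc_char n (- int l * int x) = cyc_char n (- (int l - int k) * int x)"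
      by (simp_all add: algebra_simps flip: cyc_char_add)
    show "sym_char n k (- int x) * sym_char n l (int x) =
      cyc_char n ((int l - int k) * int x) + ?s l * cyc_char n (- (int l + int k) * int x)
      + ?s k * cyc_char n ((int l + int k) * int x)
      + ?s k * ?s l * cyc_char n (- (int l - int k) * int x)"
      unfolding sym_char_def *[symmetric] by (simp add: algebra_simps)
  qed
  also have "\<dots> = (if k = l then 2 * of_nat n else 0)
      + (?s k + ?s l) * (if (k = 0 \<and> l = 0) \<or> k + l = n then of_nat n else 0)"
    unfolding sum_cyc_char[OF n] neg dvd_diff dvd_add by (auto simp: algebra_simps)
  \<comment> \<open>If \<open>k + l = n\<close> with \<open>n\<close> odd, the indices lie on
    opposite sides of \<open>n / 2\<close> and their signs cancel. Only \<open>k = l = 0\<close>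
    keeps the second term, which adds \<open>2 * n\<close>.\<close>
  also have "\<dots> = (if k = l then (if k = 0 then 4 else 2) * of_nat n else 0)"
    using assms by (auto simp: half_sign_def)
  finally show ?thesis by simp
qed

subsection \<open>Spectrum from an eigenbasis\<close>

text \<open>Rescaling the rows of \<open>W\<close> by the inverses of \<open>c\<close> gives an
  inverse of \<open>S\<close>. Hence \<open>A\<close> is similar to \<open>mat_diag n d\<close>, and
  the algebraic multiplicities can be read off the diagonal.\<close>

lemma eigenvalue_mset_eigenbasis:
  fixes A S W :: "complex mat"
  assumes A: "A \<in> carrier_mat n n" and S: "S \<in> carrier_mat n n" and W: "W \<in> carrier_mat n n"
    and WS: "W * S = mat_diag n c" and c: "\<And>k. k < n \<Longrightarrow> c k \<noteq> 0"
    and AS: "A * S = S * mat_diag n d"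
  shows "eigenvalue_mset A = image_mset d (mset_set {..<n})"
proof -
  define V where "V = mat_diag n (\<lambda>k. inverse (c k)) * W"
  have V: "V \<in> carrier_mat n n" unfolding V_def by (rule mult_carrier_mat[OF _ W]) simp
  have "V * S = mat_diag n (\<lambda>k. inverse (c k)) * mat_diag n c"
    unfolding V_def using W S WS by (simp add: assoc_mult_mat[of _ n n _ n _ n])
  also have "\<dots> = 1\<^sub>m n"
    unfolding mat_diag_diag by (rule eq_matI) (use c in \<open>auto simp: mat_diag_def\<close>)
  finally have VS: "V * S = 1\<^sub>m n" .
  have SV: "S * V = 1\<^sub>m n" by (rule mat_mult_left_right_inverse[OF V S VS])
  have "A = A * (S * V)" using A by (simp add: SV)
  also have "\<dots> = S * mat_diag n d * V"
    using A S V by (simp add: assoc_mult_mat[of _ n n _ n _ n] flip: AS)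
  finally have "similar_mat_wit A (mat_diag n d) S V"
    using A S V VS SV by (auto simp: similar_mat_wit_def)
  then have "char_poly A = char_poly (mat_diag n d)"
    by (intro char_poly_similar) (auto simp: similar_mat_def)
  also have "\<dots> = (\<Prod>a \<leftarrow> diag_mat (mat_diag n d). [:- a, 1:])"
    by (rule char_poly_upper_triangular[of _ n]) (auto simp: mat_diag_def)
  also have "diag_mat (mat_diag n d) = map d [0..<n]"
    by (auto simp: diag_mat_def mat_diag_def)
  finally have cp: "char_poly A = (\<Prod>k \<leftarrow> [0..<n]. [:- d k, 1:])" by (simp add: o_def)
  have "proots (\<Prod>k \<leftarrow> ks. [:- d k, 1:]) = image_mset d (mset ks)" for ks
  proof (induction ks)
    case (Cons k ks)
    have "(\<Prod>k \<leftarrow> ks. [:- d k, 1:]) \<noteq> 0" by (auto simp: prod_list_zero_iff)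
    then have "proots ([:- d k, 1:] * (\<Prod>k \<leftarrow> ks. [:- d k, 1:])) =
        proots [:- d k, 1:] + proots (\<Prod>k \<leftarrow> ks. [:- d k, 1:])"
      by (intro proots_mult) auto
    then show ?case using Cons.IH by simp
  qed simp
  then show ?thesis
    by (simp add: eigenvalue_mset_def cp mset_set_upto_eq_mset_upto)
qed

subsection \<open>The Laplacian matrix\<close>

text \<open>The order divides a power of \<open>p\<close>, so it is prime only if it equals
  \<open>p\<close>. This means that \<open>z\<close> is nonzero and killed by \<open>p\<close>; the
  modulus is written as \<open>p * p ^ s\<close> so that the factor \<open>p\<close>
  cancels.\<close>

lemma prime_ord_integer_mod_group_iff:
  assumes p: "prime p" and z: "0 \<le> z" "z < int (p * p ^ s)"
  shows "prime (group.ord (integer_mod_group (p * p ^ s)) z) \<longleftrightarrow> 0 < z \<and> int (p ^ s) dvd z"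
proof -
  let ?n = "p * p ^ s"
  let ?G = "integer_mod_group ?n"
  have n: "?n > 0" using p by (simp add: prime_gt_0_nat)
  interpret group ?G by simp
  have zG: "z \<in> carrier ?G" using z n by (simp add: carrier_integer_mod_group)
  have "Coset.order ?G = p ^ Suc s"
    using n by (simp add: Coset.order_def carrier_integer_mod_group nat_mult_distrib nat_power_eq)
  then have dvd: "ord z dvd p ^ Suc s" using ord_dvd_group_order[OF zG] by simp
  have "prime (ord z) \<longleftrightarrow> ord z = p"
  proof
    assume *: "prime (ord z)"
    then have "ord z dvd p" using dvd by (rule prime_dvd_power)
    then show "ord z = p" using * p by (simp add: primes_dvd_imp_eq)
  qed (use p in simp)
  also have "\<dots> \<longleftrightarrow> ord z dvd p \<and> ord z \<noteq> 1"
    using p by (auto simp: prime_nat_iff)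
  also have "ord z dvd p \<longleftrightarrow> int p * z mod int ?n = 0"
    using pow_eq_id[OF zG, of p] by simp
  also have "\<dots> \<longleftrightarrow> int (p ^ s) dvd z"
    using p by (simp add: mod_eq_0_iff_dvd prime_gt_0_nat)
  also have "ord z \<noteq> 1 \<longleftrightarrow> z \<noteq> 0"
    using pow_eq_id[OF zG, of 1] z by simp
  finally show ?thesis using z by auto
qed

text \<open>Parametrises the neighbours of \<open>x\<close>, with a loop allowed:
  \<open>x + y\<close> must be a nonzero element \<open>m * t\<close> of the subgroup of order
  \<open>p\<close>. The bijection serves both to count them and to reindex sums over them.\<close>

lemma bij_betw_multiples_shift:
  fixes p m :: nat and x :: int
  assumes "p > 0" and "m > 0"
  defines "n \<equiv> int (p * m)"
  shows "bij_betw (\<lambda>t. (int m * int t - x) mod n) {1..<p}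
    {y \<in> {0..<n}. 0 < (x + y) mod n \<and> int m dvd (x + y) mod n}"
proof -
  let ?f = "\<lambda>t. (int m * int t - x) mod n"
  have n: "n > 0" using assms by simp
  \<comment> \<open>Since \<open>m * t < n\<close>, adding \<open>x\<close> back returns
    \<open>m * t\<close> itself, and division by \<open>m\<close> recovers \<open>t\<close>.\<close>
  have shift: "(x + ?f t) mod n = int m * int t" if "t < p" for t
  proof -
    have "int m * int t < n" using that assms(2) by (simp add: n_def mult.commute flip: of_nat_mult)
    then show ?thesis by (simp add: mod_add_right_eq)
  qed
  show ?thesis
  proof (rule bij_betw_byWitness[where f' = "\<lambda>y. nat ((x + y) mod n div int m)"])
    show "\<forall>t\<in>{1..<p}. nat ((x + ?f t) mod n div int m) = t"
      using assms(2) by (simp add: shift)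
    show "?f ` {1..<p} \<subseteq> {y \<in> {0..<n}. 0 < (x + y) mod n \<and> int m dvd (x + y) mod n}"
      using assms(2) n by (auto simp: shift)
    show "\<forall>y\<in>{y \<in> {0..<n}. 0 < (x + y) mod n \<and> int m dvd (x + y) mod n}.
        ?f (nat ((x + y) mod n div int m)) = y"
    proof clarify
      fix y assume y: "y \<in> {0..<n}" "0 < (x + y) mod n" "int m dvd (x + y) mod n"
      have "int m * int (nat ((x + y) mod n div int m)) = (x + y) mod n"
        using y n by (simp add: pos_imp_zdiv_nonneg_iff assms(2))
      then show "?f (nat ((x + y) mod n div int m)) = y"
        using y(1) by (simp add: mod_diff_left_eq)
    qed
    show "(\<lambda>y. nat ((x + y) mod n div int m)) `
        {y \<in> {0..<n}. 0 < (x + y) mod n \<and> int m dvd (x + y) mod n} \<subseteq> {1..<p}"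
    proof clarify
      fix y assume y: "0 < (x + y) mod n" "int m dvd (x + y) mod n"
      then obtain q where q: "(x + y) mod n = int m * q" by (elim dvdE)
      have "int m * q < int m * int p" using n q by (metis n_def pos_mod_bound mult.commute of_nat_mult)
      then show "nat ((x + y) mod n div int m) \<in> {1..<p}"
        using y q assms(2) by (auto simp: zero_less_mult_iff)
    qed
  qed
qed

text \<open>A loop at \<open>x\<close> would add 1 to both the degree of \<open>x\<close> and the diagonal of the adjacency matrix.\<close>

lemma laplacian_matrix_integer_mod_group:
  assumes p: "prime p" and ij: "i < p * p ^ s" "j < p * p ^ s"
  shows "laplacian_matrix (map int [0..<p * p ^ s])
      (prime_order_graph (integer_mod_group (p * p ^ s))) $$ (i, j) =
    (if i = j then of_nat p - 1 else 0) -
    (if 0 < (int i + int j) mod int (p * p ^ s) \<and>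
        int (p ^ s) dvd (int i + int j) mod int (p * p ^ s) then 1 else 0)"
proof -
  define n where "n = p * p ^ s"
  define \<Gamma> where "\<Gamma> = prime_order_graph (integer_mod_group n)"
  define Y where "Y = {y \<in> {0..<int n}. 0 < (int i + y) mod int n \<and> int (p ^ s) dvd (int i + y) mod int n}"
  have n: "n > 0" using p by (simp add: n_def prime_gt_0_nat)
  have i: "int i \<in> {0..<int n}" and j: "int j \<in> {0..<int n}"
    using ij by (simp_all add: n_def flip: of_nat_mult of_nat_power)
  have arcs: "(x, y) \<in> parcs \<Gamma> \<longleftrightarrow> x \<noteq> y \<and> 0 < (x + y) mod int n \<and> int (p ^ s) dvd (x + y) mod int n"
    if "x \<in> {0..<int n}" "y \<in> {0..<int n}" for x y
    using that n prime_ord_integer_mod_group_iff[OF p, of "(x + y) mod int n" s]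
    by (auto simp: \<Gamma>_def prime_order_graph_def carrier_integer_mod_group simp flip: n_def)
  have "out_arcs (with_proj \<Gamma>) (int i) = Pair (int i) ` (Y - {int i})"
  proof -
    have "e \<in> out_arcs (with_proj \<Gamma>) (int i) \<longleftrightarrow> e \<in> Pair (int i) ` (Y - {int i})" for e
    proof (cases e)
      case (Pair a b)
      have "(a, b) \<in> parcs \<Gamma> \<Longrightarrow> b \<in> {0..<int n}"
        using n by (auto simp: \<Gamma>_def prime_order_graph_def carrier_integer_mod_group)
      then show ?thesis
        using i arcs[OF i, of b] by (auto simp: Pair out_arcs_def Y_def)
    qed
    then show ?thesis by blast
  qed
  then have "out_degree (with_proj \<Gamma>) (int i) = card (Y - {int i})"
    by (simp add: out_degree_def card_image inj_on_def)
  also have "\<dots> = card Y - (if int i \<in> Y then 1 else 0)"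
    by simp
  finally have deg: "out_degree (with_proj \<Gamma>) (int i) = card Y - (if int i \<in> Y then 1 else 0)" .
  have "card Y = p - 1"
    using bij_betw_same_card[OF bij_betw_multiples_shift[of p "p ^ s" "int i"]] p
    by (simp add: Y_def n_def prime_gt_0_nat)
  \<comment> \<open>Removing the loop does not truncate in the natural numbers, as \<open>p\<close>
    is at least 2.\<close>
  then have "(of_nat (out_degree (with_proj \<Gamma>) (int i)) :: complex)
      = of_nat p - 1 - (if int i \<in> Y then 1 else 0)"
    using prime_ge_2_nat[OF p] by (simp add: deg of_nat_diff)
  moreover have "int i \<in> Y \<longleftrightarrow> 0 < (int i + int i) mod int n \<and> int (p ^ s) dvd (int i + int i) mod int n"
    using i by (simp add: Y_def)
  ultimately show ?thesis
    using ij arcs[OF i j]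
    by (auto simp: laplacian_matrix_def degree_matrix_def adjacency_matrix_def
        simp flip: n_def \<Gamma>_def)
qed

text \<open>\<open>half_sign n k\<close> is the eigenvalue of \<open>N\<close> and the bracket that
  of \<open>J - I\<close>. The combinations of sign and divisibility give 0, 2(p-1), p and
  p-2.\<close>

definition laplacian_eigenvalue :: "nat \<Rightarrow> nat \<Rightarrow> nat \<Rightarrow> complex" where
  "laplacian_eigenvalue p n k =
     of_nat p - 1 - half_sign n k * ((if p dvd k then of_nat p else 0) - 1)"

text \<open>Over all \<open>t < p\<close> the value at \<open>- x\<close> factors out and a
  character sum over Z_p remains, with the same divisibility condition for \<open>k\<close> and
  \<open>- k\<close>. Omitting \<open>t = 0\<close> accounts for the -1.\<close>

lemma sum_sym_char_multiples:
  assumes "p > 0" and "m > 0"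
  shows "(\<Sum>t\<in>{1..<p}. sym_char (p * m) k (int m * int t - x)) =
    ((if p dvd k then of_nat p else 0) - 1) * sym_char (p * m) k (- x)"
proof -
  let ?n = "p * m"
  have char_sum: "(\<Sum>t<p. cyc_char ?n (a * (int m * int t - x))) =
      (if int p dvd a then of_nat p else 0) * cyc_char ?n (a * - x)" for a
  proof -
    have "cyc_char ?n (a * (int m * int t - x)) = cyc_char p (a * int t) * cyc_char ?n (a * - x)" for t
    proof -
      have "a * (int m * int t - x) = int m * (a * int t) + a * - x" by (simp add: algebra_simps)
      then show ?thesis by (simp only: cyc_char_add cyc_char_mult_cancel[OF assms(2)])
    qed
    then show ?thesis
      using assms(1) by (simp add: sum_cyc_char flip: sum_distrib_right)
  qed
  have "(\<Sum>t<p. sym_char ?n k (int m * int t - x)) =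
      (if p dvd k then of_nat p else 0) * sym_char ?n k (- x)"
    unfolding sym_char_def sum.distrib sum_distrib_left[symmetric] char_sum
    by (simp add: algebra_simps)
  moreover have "{..<p} = insert 0 {1..<p}" using assms(1) by auto
  ultimately show ?thesis by (simp add: algebra_simps)
qed

lemma laplacian_sym_char:
  assumes p: "prime p" and i: "i < p * p ^ s"
  shows "(\<Sum>j<p * p ^ s. laplacian_matrix (map int [0..<p * p ^ s])
      (prime_order_graph (integer_mod_group (p * p ^ s))) $$ (i, j) * sym_char (p * p ^ s) k (int j)) =
    laplacian_eigenvalue p (p * p ^ s) k * sym_char (p * p ^ s) k (int i)"
proof -
  define m where "m = p ^ s"
  define n where "n = p * m"
  define Y where "Y = {y \<in> {0..<int n}. 0 < (int i + y) mod int n \<and> int m dvd (int i + y) mod int n}"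
  have pos: "p > 0" "m > 0" "n > 0" using p by (simp_all add: prime_gt_0_nat m_def n_def)
  let ?f = "sym_char n k"
  have "(\<Sum>j<n. laplacian_matrix (map int [0..<n])
      (prime_order_graph (integer_mod_group n)) $$ (i, j) * ?f (int j)) =
    (\<Sum>j<n. (if i = j then (of_nat p - 1) * ?f (int j) else 0) - (if int j \<in> Y then ?f (int j) else 0))"
  proof (rule sum.cong[OF refl])
    fix j assume "j \<in> {..<n}"
    then have j: "j < n" by simp
    then have Y: "int j \<in> Y \<longleftrightarrow> 0 < (int i + int j) mod int n \<and> int m dvd (int i + int j) mod int n"
      by (simp add: Y_def)
    have "laplacian_matrix (map int [0..<n]) (prime_order_graph (integer_mod_group n)) $$ (i, j) =
        (if i = j then of_nat p - 1 else 0) - (if int j \<in> Y then 1 else 0)"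
      unfolding Y using laplacian_matrix_integer_mod_group[OF p i] j by (simp only: n_def m_def)
    then show "laplacian_matrix (map int [0..<n])
        (prime_order_graph (integer_mod_group n)) $$ (i, j) * ?f (int j) =
      (if i = j then (of_nat p - 1) * ?f (int j) else 0) - (if int j \<in> Y then ?f (int j) else 0)"
      by (simp add: left_diff_distrib)
  qed
  also have "\<dots> = (of_nat p - 1) * ?f (int i) - (\<Sum>j<n. if int j \<in> Y then ?f (int j) else 0)"
    using i by (simp add: sum_subtractf n_def m_def)
  also have "(\<Sum>j<n. if int j \<in> Y then ?f (int j) else 0) = (\<Sum>y\<in>{0..<int n}. if y \<in> Y then ?f y else 0)"
    by (rule sum.reindex_bij_witness[where i = nat and j = int]) auto
  also have "\<dots> = (\<Sum>y\<in>Y. ?f y)"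
    by (rule sum.mono_neutral_cong_right) (auto simp: Y_def)
  also have "\<dots> = (\<Sum>t\<in>{1..<p}. ?f ((int m * int t - int i) mod int n))"
    unfolding Y_def n_def
    by (rule sum.reindex_bij_betw[symmetric, OF bij_betw_multiples_shift[OF pos(1,2)]])
  also have "\<dots> = (\<Sum>t\<in>{1..<p}. ?f (int m * int t - int i))"
    by (intro sum.cong refl sym_char_cong) (use pos in \<open>auto simp: mod_eq_dvd_iff[symmetric]\<close>)
  \<comment> \<open>The sum produces the value at \<open>- i\<close>; returning to \<open>i\<close>
    costs the factor \<open>half_sign n k\<close>, which is the action of \<open>N\<close>.\<close>
  also have "\<dots> = ((if p dvd k then of_nat p else 0) - 1) * (half_sign n k * ?f (int i))"
    using sum_sym_char_multiples[OF pos(1,2)] by (simp add: n_def sym_char_minus)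
  finally show ?thesis
    unfolding n_def m_def laplacian_eigenvalue_def by (simp add: algebra_simps)
qed

lemma laplacian_spectrum_eq_eigenvalues:
  assumes p: "prime p" and odd: "odd p"
  shows "laplacian_spectrum (prime_order_graph (integer_mod_group (p * p ^ s))) =
    image_mset (laplacian_eigenvalue p (p * p ^ s)) (mset_set {..<p * p ^ s})"
proof -
  define n where "n = p * p ^ s"
  have n: "n > 0" "odd n" using p odd by (simp_all add: n_def prime_gt_0_nat)
  let ?G = "prime_order_graph (integer_mod_group n)"
  let ?L = "laplacian_matrix (map int [0..<n]) ?G"
  define S where "S = mat n n (\<lambda>(i, k). sym_char n k (int i))"
  \<comment> \<open>Negating the argument conjugates \<open>sym_char\<close>, so \<open>W\<close> is
    the conjugate transpose of \<open>S\<close> and \<open>W * S\<close> is the Gram matrix of the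
    eigenvectors.\<close>
  define W where "W = mat n n (\<lambda>(k, i). sym_char n k (- int i))"
  have "int ` {0..<n} = {0..<int n}" by (simp add: image_int_atLeastLessThan)
  then have "laplacian_spectrum ?G = eigenvalue_mset ?L"
    using n by (intro laplacian_spectrum_eq)
      (auto simp: prime_order_graph_def carrier_integer_mod_group distinct_map)
  also have "\<dots> = image_mset (laplacian_eigenvalue p n) (mset_set {..<n})"
  proof (rule eigenvalue_mset_eigenbasis)
    show L: "?L \<in> carrier_mat n n"
      by (simp add: laplacian_matrix_def degree_matrix_def adjacency_matrix_def minus_mat_def)
    show "S \<in> carrier_mat n n" "W \<in> carrier_mat n n" by (simp_all add: S_def W_def)
    show "W * S = mat_diag n (\<lambda>k. (if k = 0 then 4 else 2) * of_nat n)"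
      by (rule eq_matI)
         (simp_all add: W_def S_def mat_diag_def scalar_prod_def atLeast0LessThan
           sym_char_orthogonal[OF n(2)])
    show "?L * S = S * mat_diag n (laplacian_eigenvalue p n)"
    proof (rule eq_matI)
      fix i k assume "i < dim_row (S * mat_diag n (laplacian_eigenvalue p n))"
        "k < dim_col (S * mat_diag n (laplacian_eigenvalue p n))"
      then have ik: "i < n" "k < n" by (simp_all add: S_def mat_diag_def)
      have "(?L * S) $$ (i, k) = (\<Sum>j<n. ?L $$ (i, j) * sym_char n k (int j))"
        using L ik by (simp add: S_def scalar_prod_def atLeast0LessThan)
      also have "\<dots> = laplacian_eigenvalue p n k * sym_char n k (int i)"
        using laplacian_sym_char[OF p] ik by (simp add: n_def)
      also have "\<dots> = (S * mat_diag n (laplacian_eigenvalue p n)) $$ (i, k)"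
        using ik by (subst mat_diag_mult_right[of _ n]) (simp_all add: S_def)
      finally show "(?L * S) $$ (i, k) = (S * mat_diag n (laplacian_eigenvalue p n)) $$ (i, k)" .
    qed (use L in \<open>simp_all add: S_def mat_diag_def\<close>)
  qed (use n in auto)
  finally show ?thesis by (simp add: n_def)
qed

subsection \<open>Multiplicities\<close>

lemma image_mset_const_on:
  assumes "\<And>x. x \<in> A \<Longrightarrow> f x = c"
  shows "image_mset f (mset_set A) = replicate_mset (card A) c"
proof -
  \<comment> \<open>For infinite \<open>A\<close> the multiset \<open>mset_set A\<close> is empty,
    so finiteness need not be assumed.\<close>
  have "image_mset f (mset_set A) = image_mset (\<lambda>_. c) (mset_set A)"
    by (rule image_mset_cong)
       (metis assms elem_mset_set empty_iff mset_set.infinite set_mset_empty)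
  then show ?thesis by (simp add: image_mset_const_eq)
qed

lemma card_lower_half: "card {k. 2 * k < n} = (n + 1) div (2 :: nat)"
proof -
  have "{k. 2 * k < n} = {..<(n + 1) div 2}" by auto
  then show ?thesis by simp
qed

lemma card_lower_half_multiples:
  fixes p m :: nat
  assumes "p > 0"
  shows "card {k. 2 * k < p * m \<and> p dvd k} = (m + 1) div 2"
proof -
  have "{k. 2 * k < p * m \<and> p dvd k} = (*) p ` {j. 2 * j < m}"
    using assms by (auto elim!: dvdE simp: mult.left_commute[of 2])
  then show ?thesis
    using assms by (simp add: card_image inj_on_def card_lower_half)
qed

lemma card_multiples_less:
  fixes p m :: nat
  assumes "p > 0"
  shows "card {k. k < p * m \<and> p dvd k} = m"
proof -
  have "{k. k < p * m \<and> p dvd k} = (*) p ` {..<m}"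
    using assms by (auto elim!: dvdE)
  then show ?thesis
    using assms by (simp add: card_image inj_on_def)
qed

theorem proposition3p2:
  fixes p r :: nat
  assumes "prime p" and "odd p" and "r \<ge> 1"
  shows "laplacian_spectrum (prime_order_graph (integer_mod_group (p ^ r))) =
      replicate_mset ((p ^ (r - 1) + 1) div 2) 0
    + replicate_mset ((p ^ (r - 1) - 1) div 2) (2 * (of_nat p - 1))
    + replicate_mset ((p ^ r - p ^ (r - 1)) div 2) (of_nat p)
    + replicate_mset ((p ^ r - p ^ (r - 1)) div 2) (of_nat p - 2)"
proof -
  define m where "m = p ^ (r - 1)"
  define n where "n = p * m"
  have n_eq: "p ^ r = n" using assms(3) by (simp add: n_def m_def flip: power_Suc)
  have p: "p > 0" using assms(1) by (rule prime_gt_0_nat)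
  have odd: "odd m" "odd n" using assms(2) by (simp_all add: m_def n_def)
  have mn: "m \<le> n" using p by (simp add: n_def)
  \<comment> \<open>\<open>A\<close> and \<open>B\<close> hold the multiples of \<open>p\<close>
    below and above \<open>n / 2\<close>, \<open>C\<close> and \<open>D\<close> the other indices
    below and above. They carry the eigenvalues 0, 2(p-1), p and p-2 in this order.\<close>
  define A where "A = {k. 2 * k < n \<and> p dvd k}"
  define B where "B = {k. k < n \<and> p dvd k} - A"
  define C where "C = {k. 2 * k < n} - A"
  define D where "D = {..<n} - {k. 2 * k < n} - B"
  have fin: "finite A" "finite B" "finite C" "finite D"
    by (auto simp: A_def B_def C_def D_def intro: finite_subset[of _ "{..<n}"])
  have cA: "card A = (m + 1) div 2"
    using card_lower_half_multiples[OF p] by (simp add: A_def n_def)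
  have "card B = m - (m + 1) div 2"
    unfolding B_def using card_multiples_less[OF p, of m] fin cA
    by (subst card_Diff_subset) (auto simp: A_def n_def)
  then have cB: "card B = (m - 1) div 2" using odd by (auto elim!: oddE)
  have "card C = (n + 1) div 2 - (m + 1) div 2"
    unfolding C_def using fin cA by (subst card_Diff_subset) (auto simp: A_def card_lower_half)
  then have cC: "card C = (n - m) div 2" using odd mn by (auto elim!: oddE)
  \<comment> \<open>For odd \<open>n\<close> the upper half has \<open>(n - 1) / 2\<close> indices,
    one fewer than the lower half, which contains 0. The same shift separates \<open>B\<close> from
    \<open>A\<close>, so \<open>C\<close> and \<open>D\<close> have equal size.\<close>
  have "card D = n - (n + 1) div 2 - (m - 1) div 2"
    unfolding D_def using fin cB
    by (subst card_Diff_subset, simp, force simp: A_def B_def, subst card_Diff_subset)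
       (auto simp: card_lower_half intro: finite_subset[of _ "{..<n}"])
  then have cD: "card D = (n - m) div 2" using odd mn by (auto elim!: oddE)
  have "{..<n} = A \<union> B \<union> C \<union> D" "A \<inter> B = {}" "(A \<union> B) \<inter> C = {}" "(A \<union> B \<union> C) \<inter> D = {}"
    by (auto simp: A_def B_def C_def D_def)
  then have split: "mset_set {..<n} = mset_set A + mset_set B + mset_set C + mset_set D"
    using fin by (simp add: mset_set_Union)
  let ?f = "laplacian_eigenvalue p n"
  have "image_mset ?f (mset_set A) = replicate_mset ((m + 1) div 2) 0"
    unfolding cA[symmetric]
    by (rule image_mset_const_on) (simp add: A_def laplacian_eigenvalue_def half_sign_def)
  moreover have "image_mset ?f (mset_set B) = replicate_mset ((m - 1) div 2) (2 * (of_nat p - 1))"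
    unfolding cB[symmetric]
    by (rule image_mset_const_on) (auto simp: A_def B_def laplacian_eigenvalue_def half_sign_def)
  moreover have "image_mset ?f (mset_set C) = replicate_mset ((n - m) div 2) (of_nat p)"
    unfolding cC[symmetric]
    by (rule image_mset_const_on) (auto simp: A_def C_def laplacian_eigenvalue_def half_sign_def)
  moreover have "image_mset ?f (mset_set D) = replicate_mset ((n - m) div 2) (of_nat p - 2)"
    unfolding cD[symmetric]
    by (rule image_mset_const_on) (auto simp: A_def B_def D_def laplacian_eigenvalue_def half_sign_def)
  ultimately show ?thesis
    using laplacian_spectrum_eq_eigenvalues[OF assms(1,2), of "r - 1"]
    unfolding m_def[symmetric] n_def[symmetric] n_eq split by simp
qed

end
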